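(* Let $f>2$ be an integer and $\tau>1$. There are no generically timelike minimizers of the action $S$ on the flag manifold $F=F^{1,2}(\mathbb{C}^f)$ (with parameter $\tau$) if $$\tau^2>\frac{3f+2\sqrt{3\,(f^2-1)}}{2+f}.$$
   Context: For a real parameter $\tau>1$ and an integer $f>2$, let $F$ be the space of Hermitian $f\times f$-matrices of rank two whose non-trivial eigenvalues are equal to $1+\tau$ and $1-\tau$. Associating to $x\in F$ its eigenspaces $U$ (for $1+\tau$) and $V$ (for $1-\tau$) and the chain $U\subset U\oplus V$, $F$ is identified with the flag manifold $F^{1,2}(\mathbb{C}^f)$ of one-dimensional subspaces contained in a two-dimensional subspace of $\mathbb{C}^f$; it is a $(4f-6)$-dimensional compact manifold and a homogeneous space of $U(f)$ under $x\mapsto UxU^{-1}$. Define $$D(x,y)=\operatorname{Tr}\big((xy)^2\big)-\tfrac12\big(\operatorname{Tr}(xy)\big)^2,\qquad L=\max(0,D).$$ $\mathfrak{M}$ is the set of all normalized (total mass one) positive regular Borel measures on $F$; $S[\rho]=\iint_{F\times F}L(x,y)\,d\rho(x)\,d\rho(y)$. A minimizer is a $\rho\in\mathfrak{M}$ with $S[\rho]=\inf_{\tilde\rho\in\mathfrak{M}}S[\tilde\rho]$. A minimizer $\rho$ is called generically timelike if (i) $D(x,y)\ge0$ for all $x,y\in\operatorname{supp}\rho$, and (ii) the function $d(x)=\int_FD(x,y)\,d\rho(y)$ is constant on $F$. *)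

theory Defs
  imports "HOL-Probability.Probability"
begin

text \<open>
  The integer \<open>f\<close> is rendered as \<open>CARD('n)\<close> for a finite index type \<open>'n\<close>, so that
  \<open>complex^'n^'n\<close> is the space of complex \<open>f \<times> f\<close> matrices.
\<close>

definition conj_transpose :: "complex^'n^'m \<Rightarrow> complex^'m^'n" where
  "conj_transpose A = (\<chi> i j. cnj (A $ j $ i))"

definition hermitian :: "complex^'n^'n \<Rightarrow> bool" where
  "hermitian A \<longleftrightarrow> conj_transpose A = A"

definition eigenvalue :: "complex^'n^'n \<Rightarrow> complex \<Rightarrow> bool" where
  "eigenvalue A c \<longleftrightarrow> (\<exists>v. v \<noteq> 0 \<and> A *v v = c *s v)"

text \<open>
  As the rank is two and the two listed eigenvalues are distinct and non-zero (for \<open>\<tau> > 1\<close>), each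
  of them has multiplicity one.
\<close>

definition flag :: "real \<Rightarrow> (complex^'n^'n) set" where
  "flag \<tau> = {x. hermitian x \<and> rank x = 2 \<and>
                {c. c \<noteq> 0 \<and> eigenvalue x c} = {complex_of_real (1 + \<tau>), complex_of_real (1 - \<tau>)}}"

text \<open>
  On Hermitian matrices both traces are real (see below), so taking real parts only
  adjusts the type.
\<close>

definition D :: "complex^'n^'n \<Rightarrow> complex^'n^'n \<Rightarrow> real" where
  "D x y = Re (trace ((x ** y) ** (x ** y))) - 1/2 * (Re (trace (x ** y)))\<^sup>2"

definition L :: "complex^'n^'n \<Rightarrow> complex^'n^'n \<Rightarrow> real" where
  "L x y = max 0 (D x y)"

definition regular_measure_on :: "'a::topological_space set \<Rightarrow> 'a measure \<Rightarrow> bool" where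
  "regular_measure_on F \<rho> \<longleftrightarrow>
     (\<forall>B\<in>sets \<rho>.
        emeasure \<rho> B = (SUP K\<in>{K. K \<subseteq> B \<and> compact K}. emeasure \<rho> K) \<and>
        emeasure \<rho> B = (INF U\<in>{U. B \<subseteq> U \<and> openin (top_of_set F) U}. emeasure \<rho> U))"

definition normalized_measures :: "real \<Rightarrow> (complex^'n^'n) measure set" where
  "normalized_measures \<tau> =
     {\<rho>. sets \<rho> = sets (restrict_space borel (flag \<tau>)) \<and> prob_space \<rho> \<and>
         regular_measure_on (flag \<tau>) \<rho>}"

definition action :: "(complex^'n^'n) measure \<Rightarrow> real" where
  "action \<rho> = (\<integral>z. L (fst z) (snd z) \<partial>(\<rho> \<Otimes>\<^sub>M \<rho>))"

definition minimizer :: "real \<Rightarrow> (complex^'n^'n) measure \<Rightarrow> bool" where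
  "minimizer \<tau> \<rho> \<longleftrightarrow>
     \<rho> \<in> normalized_measures \<tau> \<and>
     action \<rho> = (INF \<rho>'\<in>(normalized_measures \<tau> :: (complex^'n^'n) measure set). action \<rho>')"

definition supp :: "'a::topological_space measure \<Rightarrow> 'a set" where
  "supp \<rho> = {x \<in> space \<rho>. \<forall>U. openin (top_of_set (space \<rho>)) U \<longrightarrow> x \<in> U \<longrightarrow> emeasure \<rho> U > 0}"

definition generically_timelike_minimizer :: "real \<Rightarrow> (complex^'n^'n) measure \<Rightarrow> bool" where
  "generically_timelike_minimizer \<tau> \<rho> \<longleftrightarrow>
     minimizer \<tau> \<rho> \<and>
     (\<forall>x\<in>supp \<rho>. \<forall>y\<in>supp \<rho>. D x y \<ge> 0) \<and>
     (\<lambda>x. \<integral>y. D x y \<partial>\<rho>) constant_on flag \<tau>"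

lemma conj_transpose_mult: "conj_transpose (A ** B) = conj_transpose B ** conj_transpose A"
  by (simp add: conj_transpose_def matrix_matrix_mult_def vec_eq_iff cnj_sum mult.commute)

lemma trace_conj_transpose: "trace (conj_transpose A) = cnj (trace A)"
  by (simp add: conj_transpose_def trace_def)

lemma trace_hermitian_mult_real:
  assumes "hermitian x" "hermitian y"
  shows "trace (x ** y) \<in> \<real>" "trace ((x ** y) ** (x ** y)) \<in> \<real>"
proof -
  have xy: "conj_transpose (x ** y) = y ** x"
    using assms by (simp add: conj_transpose_mult hermitian_def)
  have "cnj (trace (x ** y)) = trace (x ** y)"
    by (metis xy trace_conj_transpose trace_mul_sym)
  then show "trace (x ** y) \<in> \<real>" by (simp add: Reals_cnj_iff)
  have "cnj (trace ((x ** y) ** (x ** y))) = trace ((y ** x) ** (y ** x))"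
    by (metis xy conj_transpose_mult trace_conj_transpose)
  also have "\<dots> = trace ((x ** y) ** (x ** y))"
    by (metis matrix_mul_assoc trace_mul_sym)
  finally show "trace ((x ** y) ** (x ** y)) \<in> \<real>" by (simp add: Reals_cnj_iff)
qed

lemma of_real_D:
  assumes "hermitian x" "hermitian y"
  shows "complex_of_real (D x y) = trace ((x ** y) ** (x ** y)) - 1/2 * (trace (x ** y))\<^sup>2"
  using trace_hermitian_mult_real[OF assms] by (simp add: D_def)

end

theory Submission
  imports Defs
begin

text \<open>
  Write \<open>c\<close> for the constant value of \<open>d\<close>. As \<open>D \<ge> 0\<close> on the support, which has full measure,
  \<open>c \<ge> 0\<close>. On the other hand \<open>c\<close> is the value of any weighted average (of total weight one) of
  \<open>d\<close> over finitely many points of \<open>F\<close>. The Haar average of \<open>D(\<cdot>, y)\<close> does not depend on \<open>y\<close> and is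
  negative precisely under the hypothesis on \<open>\<tau>\<close>. Since \<open>D(x, y)\<close> is quadratic in \<open>x\<close>, that average
  is reproduced by a finite signed family: the flags in the coordinate planes spanned by \<open>e\<^sub>i, e\<^sub>j\<close>
  whose lines are the coordinate axes or are spanned by \<open>e\<^sub>i \<plusminus> \<omega> e\<^sub>j\<close> with \<open>\<omega>\<close> a fourth root of unity.
\<close>

section \<open>Hermitian inner product and rank-two spectral sums\<close>

definition cip :: "complex^'n \<Rightarrow> complex^'n \<Rightarrow> complex" where
  "cip s t = (\<Sum>i\<in>UNIV. cnj (s $ i) * t $ i)"

definition rank_one :: "complex^'n \<Rightarrow> complex^'n \<Rightarrow> complex^'n^'n" where
  "rank_one s t = (\<chi> i j. s $ i * cnj (t $ j))"

text \<open>For orthonormal \<open>u\<close> and \<open>v\<close> this is a spectral decomposition.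
  Explicit vectors turn traces against it into matrix elements.\<close>

definition spectral :: "real \<Rightarrow> real \<Rightarrow> complex^'n \<Rightarrow> complex^'n \<Rightarrow> complex^'n^'n" where
  "spectral a b u v = a *\<^sub>R rank_one u u + b *\<^sub>R rank_one v v"

lemma spectral_nth:
  "spectral a b u v $ i $ j = of_real a * (u $ i * cnj (u $ j)) + of_real b * (v $ i * cnj (v $ j))"
  by (simp add: spectral_def rank_one_def) (simp add: scaleR_conv_of_real)

lemma cip_add_right: "cip s (t + t') = cip s t + cip s t'"
  by (simp add: cip_def distrib_left sum.distrib)

lemma cip_smult_right: "cip s (c *s t) = c * cip s t"
  by (simp add: cip_def sum_distrib_left mult_ac)

lemma cip_add_left: "cip (s + s') t = cip s t + cip s' t"
  by (simp add: cip_def distrib_right sum.distrib)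

lemma cip_smult_left: "cip (c *s s) t = cnj c * cip s t"
  by (simp add: cip_def sum_distrib_left mult_ac)

lemma cip_commute: "cip s t = cnj (cip t s)"
  by (simp add: cip_def mult.commute)

lemma cip_self: "cip s s = of_real ((norm s)\<^sup>2)"
  by (simp add: cip_def norm_vec_def L2_set_def sum_nonneg complex_norm_square mult.commute
      flip: of_real_power)

lemma cip_axis: "cip (axis i 1) t = t $ i"
proof -
  have "cip (axis i 1) t = (\<Sum>k\<in>UNIV. if k = i then t $ k else 0)"
    unfolding cip_def by (rule sum.cong) (auto simp: axis_def)
  then show ?thesis by simp
qed

lemma hermitian_nth: "hermitian y \<Longrightarrow> cnj (y $ i $ j) = y $ j $ i"
  unfolding hermitian_def conj_transpose_def by (metis vec_lambda_beta)

lemma cip_hermitian: "hermitian y \<Longrightarrow> cip s (y *v t) = cip (y *v s) t"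
  unfolding cip_def matrix_vector_mult_def
  by (simp add: sum_distrib_left sum_distrib_right hermitian_nth mult_ac) (rule sum.swap)

lemma spectral_mult_vec:
  "spectral a b u v *v w = (of_real a * cip u w) *s u + (of_real b * cip v w) *s v"
  by (simp add: vec_eq_iff matrix_vector_mult_def spectral_nth cip_def sum_distrib_left
      sum_distrib_right sum.distrib algebra_simps)

lemma hermitian_spectral: "hermitian (spectral a b u v)"
  by (simp add: hermitian_def conj_transpose_def vec_eq_iff spectral_nth mult_ac)

section \<open>Flags as orthonormal pairs of eigenvectors\<close>

definition vcnj :: "complex^'n \<Rightarrow> complex^'n" where
  "vcnj u = (\<chi> i. cnj (u $ i))"

text \<open>The rank is handled as a row rank, which brings in conjugated eigenvectors. Conjugating
  \<open>y *v u = c *s u\<close>, with \<open>y\<close> Hermitian and \<open>c\<close> real, writes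
  \<open>c *s vcnj u\<close> as a combination of the rows, and \<open>c\<close> can be divided
  out.\<close>

lemma vcnj_in_span_rows:
  assumes "hermitian y" "y *v u = c *s u" "c \<noteq> 0" "c \<in> \<real>"
  shows "vcnj u \<in> vec.span (rows y)"
proof -
  have eq: "vcnj u = inverse c *s (\<Sum>k\<in>UNIV. cnj (u $ k) *s row k y)"
  proof -
    have "c * cnj (u $ j) = (\<Sum>k\<in>UNIV. cnj (u $ k) * y $ k $ j)" for j
    proof -
      have "(y *v u) $ j = c * u $ j" using assms by simp
      then have "cnj ((y *v u) $ j) = c * cnj (u $ j)" using assms by (simp add: Reals_cnj_iff)
      then show ?thesis using assms
        by (simp add: matrix_vector_mult_def hermitian_nth mult.commute)
    qed
    then show ?thesis using assms
      by (simp add: vec_eq_iff vcnj_def row_def field_simps)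
  qed
  show ?thesis unfolding eq
    by (intro vec.span_scale vec.span_sum vec.span_base) (auto simp: rows_def)
qed

text \<open>A relation \<open>vcnj u = c *s vcnj v\<close> would make \<open>u\<close> a multiple of
  \<open>v\<close>; orthogonality then forces \<open>cip u u = 0\<close>.\<close>

lemma independent_vcnj:
  assumes "cip u v = 0" "u \<noteq> 0" "v \<noteq> 0"
  shows "vec.independent {vcnj u, vcnj v}" "vcnj u \<noteq> vcnj v"
proof -
  have nu: "cip u u \<noteq> 0" "cip v v \<noteq> 0" using assms by (simp_all add: cip_self)
  have *: "vcnj u \<noteq> c *s vcnj v" for c
  proof
    assume "vcnj u = c *s vcnj v"
    then have "cnj (u $ i) = c * cnj (v $ i)" for i by (simp add: vcnj_def vec_eq_iff)
    then have "u $ i = cnj c * v $ i" for i by (metis complex_cnj_cnj complex_cnj_mult)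
    then have "u = cnj c *s v" by (simp add: vec_eq_iff)
    then have "cip u v = c * cip v v" "cip u u = cnj c * cip u v"
      by (simp add: cip_smult_left, metis cip_smult_right)
    then show False using assms nu by simp
  qed
  have v0: "vcnj v \<noteq> 0" using assms by (auto simp: vcnj_def vec_eq_iff)
  show ne: "vcnj u \<noteq> vcnj v" using *[of 1] by simp
  show "vec.independent {vcnj u, vcnj v}"
    using * v0 by (auto simp: vec.independent_insert vec.span_singleton ne)
qed

text \<open>The row space is spanned by \<open>vcnj u\<close> and \<open>vcnj v\<close>, so the rank
  is two. An eigenvector for a further non-zero eigenvalue would be orthogonal to \<open>u\<close>
  and \<open>v\<close>, hence annihilated by the matrix.\<close>

lemma spectral_in_flag:
  fixes u v :: "complex^'n"
  assumes "\<tau> > 1" "cip u u = 1" "cip v v = 1" "cip u v = 0"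
  shows "spectral (1 + \<tau>) (1 - \<tau>) u v \<in> flag \<tau>"
proof -
  let ?x = "spectral (1 + \<tau>) (1 - \<tau>) u v"
  let ?a = "complex_of_real (1 + \<tau>)" and ?b = "complex_of_real (1 - \<tau>)"
  have vu: "cip v u = 0" using assms(4) by (subst cip_commute) simp
  have nz: "?a \<noteq> 0" "?b \<noteq> 0" using assms(1) by (simp_all add: complex_eq_iff)
  have uv0: "u \<noteq> 0" "v \<noteq> 0" using assms(2,3) by (auto simp: cip_def)
  have eu: "?x *v u = ?a *s u" and ev: "?x *v v = ?b *s v"
    unfolding spectral_mult_vec using assms vu by simp_all
  have h: "hermitian ?x" by (rule hermitian_spectral)
  have ind: "vec.independent {vcnj u, vcnj v}" "vcnj u \<noteq> vcnj v"
    using independent_vcnj[OF assms(4) uv0] by auto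
  have "rows ?x \<subseteq> vec.span {vcnj u, vcnj v}"
  proof
    fix r assume "r \<in> rows ?x"
    then obtain i where "r = row i ?x" by (auto simp: rows_def)
    then have "r = (?a * u $ i) *s vcnj u + (?b * v $ i) *s vcnj v"
      by (simp add: vec_eq_iff row_def spectral_nth vcnj_def algebra_simps)
    then show "r \<in> vec.span {vcnj u, vcnj v}"
      by (simp add: vec.span_add vec.span_scale vec.span_base)
  qed
  moreover have "{vcnj u, vcnj v} \<subseteq> vec.span (rows ?x)"
    using vcnj_in_span_rows[OF h eu nz(1)] vcnj_in_span_rows[OF h ev nz(2)] by auto
  ultimately have "vec.span {vcnj u, vcnj v} = vec.span (rows ?x)"
    by (meson subset_antisym vec.span_minimal vec.subspace_span)
  then have "rank ?x = 2"
    unfolding row_rank_def_gen using vec.dim_eq_card[OF _ ind(1), of "rows ?x"] ind(2) by simp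
  moreover have "{c. c \<noteq> 0 \<and> eigenvalue ?x c} = {?a, ?b}"
  proof -
    have "c = ?a \<or> c = ?b" if "c \<noteq> 0" "w \<noteq> 0" "?x *v w = c *s w" for c w
    proof (rule ccontr)
      assume "\<not> ?thesis"
      moreover have "c * cip u w = ?a * cip u w" "c * cip v w = ?b * cip v w"
        by (metis cip_smult_right cip_smult_left that(3) cip_hermitian[OF h] eu complex_cnj_complex_of_real)
           (metis cip_smult_right cip_smult_left that(3) cip_hermitian[OF h] ev complex_cnj_complex_of_real)
      ultimately have "cip u w = 0" "cip v w = 0" by auto
      then have "?x *v w = 0" by (simp add: spectral_mult_vec)
      then show False using that by simp
    qed
    moreover have "eigenvalue ?x ?a" "eigenvalue ?x ?b"
      unfolding eigenvalue_def using uv0 eu ev by blast+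
    ultimately show ?thesis
      using nz by (auto simp only: eigenvalue_def)
  qed
  ultimately show ?thesis using h by (simp add: flag_def)
qed

text \<open>
  The conjugates of the two eigenvectors lie in the row space of \<open>y\<close>, hence span it as the rank is
  two; the coefficients of the rows are then read off from \<open>y u\<close> and \<open>y v\<close>.
\<close>

lemma flag_imp_spectral:
  fixes y :: "complex^'n^'n"
  assumes "\<tau> > 1" "y \<in> flag \<tau>"
  obtains u v where "cip u u = 1" "cip v v = 1" "cip u v = 0"
    "y = spectral (1 + \<tau>) (1 - \<tau>) u v"
proof -
  let ?a = "complex_of_real (1 + \<tau>)" and ?b = "complex_of_real (1 - \<tau>)"
  have h: "hermitian y" and rk: "rank y = 2"
    and ev: "{c. c \<noteq> 0 \<and> eigenvalue y c} = {?a, ?b}" using assms(2) by (auto simp: flag_def)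
  have nz: "?a \<noteq> 0" "?b \<noteq> 0" "?a \<noteq> ?b" using assms(1) by (simp_all add: complex_eq_iff)
  have normalized: "\<exists>w. cip w w = 1 \<and> y *v w = c *s w" if ec: "eigenvalue y c" for c
  proof -
    obtain w where w: "w \<noteq> 0" "y *v w = c *s w" using ec unfolding eigenvalue_def by blast
    let ?w = "of_real (inverse (norm w)) *s w"
    have "cip ?w ?w = 1" using w
      unfolding cip_smult_left cip_smult_right cip_self[of w] by (simp add: power2_eq_square field_simps)
    moreover have "y *v ?w = c *s ?w"
      using w(2) by (simp add: matrix_vector_mult_scaleR vector_smult_assoc mult.commute
          vec.scale)
    ultimately show ?thesis by blast
  qed
  have "eigenvalue y ?a" "eigenvalue y ?b" using ev by blast+
  then obtain u v where u: "cip u u = 1" "y *v u = ?a *s u" and v: "cip v v = 1" "y *v v = ?b *s v"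
    using normalized by metis
  have "?b * cip u v = ?a * cip u v"
    by (metis cip_smult_right cip_smult_left v(2) cip_hermitian[OF h] u(2) complex_cnj_complex_of_real)
  then have uv: "cip u v = 0" using nz by simp
  then have vu: "cip v u = 0" by (subst cip_commute) simp
  have uv0: "u \<noteq> 0" "v \<noteq> 0" using u v by (auto simp: cip_def)
  note ind = independent_vcnj[OF uv uv0]
  have "vec.span (rows y) \<subseteq> vec.span {vcnj u, vcnj v}"
  proof (rule vec.card_ge_dim_independent)
    show "{vcnj u, vcnj v} \<subseteq> vec.span (rows y)"
      using vcnj_in_span_rows[OF h u(2) nz(1)] vcnj_in_span_rows[OF h v(2) nz(2)] by auto
    show "vec.dim (vec.span (rows y)) \<le> card {vcnj u, vcnj v}"
      using rk ind by (simp add: row_rank_def_gen)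
  qed (rule ind)
  then have "row i y \<in> vec.span {vcnj u, vcnj v}" for i
    by (metis (mono_tags, lifting) CollectI UNIV_I rows_def subsetD vec.span_base)
  then have "\<exists>p q. row i y = p *s vcnj u + q *s vcnj v" for i
    unfolding vec.span_breakdown_eq[of _ "vcnj u"] vec.span_singleton
    by (metis (no_types, lifting) add.commute diff_add_cancel rangeE)
  then obtain p q where pq: "\<And>i. row i y = p i *s vcnj u + q i *s vcnj v" by metis
  have y: "y $ i $ j = p i * cnj (u $ j) + q i * cnj (v $ j)" for i j
    using pq[of i] by (simp add: vec_eq_iff row_def vcnj_def)
  have yw: "(y *v w) $ i = p i * cip u w + q i * cip v w" for w i
    by (simp add: matrix_vector_mult_def y cip_def sum_distrib_left sum.distrib algebra_simps)
  have "p i = ?a * u $ i" "q i = ?b * v $ i" for i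
    using yw[of u i] yw[of v i] by (simp_all only: u v uv vu vector_smult_component mult_1_right mult_zero_right add_0_left add_0_right)
  then have "y = spectral (1 + \<tau>) (1 - \<tau>) u v"
    by (simp add: vec_eq_iff y spectral_nth mult.assoc)
  then show thesis using that u v uv by blast
qed

section \<open>Traces and \<open>D\<close> through matrix elements\<close>

lemma trace_spectral: "trace (spectral a b u v) = of_real a * cip u u + of_real b * cip v v"
  by (simp add: trace_def spectral_nth cip_def sum_distrib_left sum.distrib mult_ac)

lemma trace_spectral_mult:
  "trace (spectral a b u v ** y) = of_real a * cip u (y *v u) + of_real b * cip v (y *v v)"
proof -
  have "trace (spectral a b u v ** y) = (\<Sum>i\<in>UNIV. \<Sum>k\<in>UNIV. spectral a b u v $ i $ k * y $ k $ i)"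
    by (simp add: trace_def matrix_matrix_mult_def)
  also have "\<dots> = (\<Sum>k\<in>UNIV. \<Sum>i\<in>UNIV. spectral a b u v $ i $ k * y $ k $ i)" by (rule sum.swap)
  also have "\<dots> = of_real a * cip u (y *v u) + of_real b * cip v (y *v v)"
    by (simp add: spectral_nth cip_def matrix_vector_mult_def sum_distrib_left sum.distrib
        algebra_simps)
  finally show ?thesis .
qed

text \<open>Only the compression of \<open>y\<close> to \<open>u\<close>, \<open>v\<close> matters.
  With diagonal entries P, Q and off-diagonal entry z, Tr(xy) = aP + bQ and Tr((xy)^2) = a^2 P^2 +
  b^2 Q^2 + 2ab|z|^2; subtracting half the square of the former leaves the mixed term ab(2|z|^2 -
  PQ).\<close>

lemma D_spectral:
  assumes "hermitian y"
  shows "D (spectral a b u v) y = a\<^sup>2 * (Re (cip u (y *v u)))\<^sup>2 / 2 + b\<^sup>2 * (Re (cip v (y *v v)))\<^sup>2 / 2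
    + a * b * (2 * (cmod (cip u (y *v v)))\<^sup>2 - Re (cip u (y *v u)) * Re (cip v (y *v v)))"
proof -
  let ?x = "spectral a b u v"
  define P where "P = Re (cip u (y *v u))"
  define Q where "Q = Re (cip v (y *v v))"
  have real: "cip w (y *v w) = of_real (Re (cip w (y *v w)))" for w
    using cip_hermitian[OF assms, of w w] cip_commute[of w "y *v w"]
    by (metis Reals_cnj_iff of_real_Re)
  have P: "cip u (y *v u) = of_real P" and Q: "cip v (y *v v) = of_real Q"
    unfolding P_def Q_def by (rule real)+
  have vu: "cip v (y *v u) = cnj (cip u (y *v v))"
    by (metis cip_hermitian[OF assms] cip_commute)
  \<comment> \<open>Regrouping makes \<open>trace_spectral_mult\<close> applicable with
    \<open>y ** ?x ** y\<close> as second factor.\<close>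
  have "trace ((?x ** y) ** (?x ** y)) = trace (?x ** (y ** ?x ** y))"
    by (simp add: matrix_mul_assoc)
  also have "\<dots> = of_real (a\<^sup>2 * P\<^sup>2 + b\<^sup>2 * Q\<^sup>2) + 2 * of_real (a * b) * (cip u (y *v v) * cnj (cip u (y *v v)))"
    by (simp add: trace_spectral_mult spectral_mult_vec matrix_vector_mul_assoc[symmetric] 
        matrix_vector_right_distrib vec.scale cip_add_right cip_smult_right P Q vu)
      (simp add: power2_eq_square algebra_simps)
  also have "\<dots> = of_real (a\<^sup>2 * P\<^sup>2 + b\<^sup>2 * Q\<^sup>2 + 2 * (a * b) * (cmod (cip u (y *v v)))\<^sup>2)"
    by (simp add: complex_norm_square[symmetric])
  finally have *: "Re (trace ((?x ** y) ** (?x ** y))) = a\<^sup>2 * P\<^sup>2 + b\<^sup>2 * Q\<^sup>2 + 2 * (a * b) * (cmod (cip u (y *v v)))\<^sup>2"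
    by (metis Re_complex_of_real)
  have "Re (trace (?x ** y)) = a * P + b * Q"
    by (simp add: trace_spectral_mult P Q)
  then show ?thesis unfolding D_def * P_def[symmetric] Q_def[symmetric]
    by (simp add: power2_eq_square field_simps)
qed

text \<open>The sum of the eigenvalues and that of their squares: the only data about
  \<open>y\<close> that survive in the averaged \<open>D\<close>.\<close>

lemma trace_flag:
  assumes "\<tau> > 1" "y \<in> flag \<tau>"
  shows "trace y = 2" "trace (y ** y) = of_real (2 + 2 * \<tau>\<^sup>2)"
proof -
  obtain u v where uv: "cip u u = 1" "cip v v = 1" "cip u v = 0"
    and y: "y = spectral (1 + \<tau>) (1 - \<tau>) u v"
    using flag_imp_spectral[OF assms] by blast
  have vu: "cip v u = 0" using uv(3) by (subst cip_commute) simp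
  have yu: "y *v u = of_real (1 + \<tau>) *s u" and yv: "y *v v = of_real (1 - \<tau>) *s v"
    unfolding y spectral_mult_vec using uv vu by simp_all
  show "trace y = 2" by (simp add: y trace_spectral uv)
  have "trace (y ** y) = of_real ((1 + \<tau>)\<^sup>2 + (1 - \<tau>)\<^sup>2)"
    by (subst (1) y) (simp only: trace_spectral_mult yu yv cip_smult_right uv mult_1_right
        power2_eq_square of_real_add of_real_mult)
  also have "(1 + \<tau>)\<^sup>2 + (1 - \<tau>)\<^sup>2 = 2 + 2 * \<tau>\<^sup>2" by (simp add: power2_eq_square algebra_simps)
  finally show "trace (y ** y) = of_real (2 + 2 * \<tau>\<^sup>2)" .
qed

lemma sum_cmod_square_hermitian:
  assumes "hermitian y"
  shows "(\<Sum>i\<in>UNIV. \<Sum>j\<in>UNIV. (cmod (y $ i $ j))\<^sup>2) = Re (trace (y ** y))"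
proof -
  have "of_real ((cmod (y $ i $ j))\<^sup>2) = y $ i $ j * y $ j $ i" for i j
    unfolding complex_norm_square hermitian_nth[OF assms] ..
  then have "complex_of_real (\<Sum>i\<in>UNIV. \<Sum>j\<in>UNIV. (cmod (y $ i $ j))\<^sup>2) = trace (y ** y)"
    by (simp add: trace_def matrix_matrix_mult_def del: of_real_power)
  then show ?thesis by (metis Re_complex_of_real)
qed

lemma cip_axis_mult: "cip (axis i 1) (y *v axis j 1) = y $ i $ j"
proof -
  have "(y *v axis j 1) $ i = (\<Sum>k\<in>UNIV. if k = j then y $ i $ k else 0)"
    unfolding matrix_vector_mult_def vec_lambda_beta by (rule sum.cong) (auto simp: axis_def)
  then show ?thesis by (simp add: cip_axis)
qed

section \<open>Test flags in the coordinate planes\<close>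

definition diag_flag :: "real \<Rightarrow> 'n \<Rightarrow> 'n \<Rightarrow> complex^'n^'n" where
  "diag_flag \<tau> i j = spectral (1 + \<tau>) (1 - \<tau>) (axis i 1) (axis j 1)"

text \<open>For \<open>i \<noteq> j\<close> and unimodular \<open>\<omega>\<close>, the vectors for
  \<open>\<omega>\<close> and \<open>- \<omega>\<close> form an orthonormal basis of the coordinate
  plane.\<close>

definition tilted_vec :: "complex \<Rightarrow> 'n \<Rightarrow> 'n \<Rightarrow> complex^'n" where
  "tilted_vec \<omega> i j = of_real (1 / sqrt 2) *s (axis i 1 + \<omega> *s axis j 1)"

text \<open>Passing from \<open>\<omega>\<close> to \<open>- \<omega>\<close> exchanges the two
  eigenlines.\<close>

definition tilted_flag :: "real \<Rightarrow> complex \<Rightarrow> 'n \<Rightarrow> 'n \<Rightarrow> complex^'n^'n" where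
  "tilted_flag \<tau> \<omega> i j =
     spectral (1 + \<tau>) (1 - \<tau>) (tilted_vec \<omega> i j) (tilted_vec (- \<omega>) i j)"

lemma cip_tilted_mult:
  "cip (tilted_vec \<omega> i j) (y *v tilted_vec \<omega>' i j) =
    (y $ i $ i + \<omega>' * y $ i $ j + cnj \<omega> * y $ j $ i + cnj \<omega> * \<omega>' * y $ j $ j) / 2"
proof -
  have s: "complex_of_real (1 / sqrt 2) * (complex_of_real (1 / sqrt 2) * c) = c / 2" for c
    by (simp flip: of_real_mult mult.assoc)
  show ?thesis
    unfolding tilted_vec_def vec.scale cip_smult_left cip_smult_right complex_cnj_complex_of_real s
    by (simp add: matrix_vector_right_distrib vec.scale cip_add_left cip_add_right
        cip_smult_left cip_smult_right cip_axis_mult algebra_simps)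
qed

lemma diag_flag_in_flag: "\<tau> > 1 \<Longrightarrow> i \<noteq> j \<Longrightarrow> diag_flag \<tau> i j \<in> flag \<tau>"
  unfolding diag_flag_def by (intro spectral_in_flag) (simp_all only: cip_axis, simp_all add: axis_def)

lemma tilted_flag_in_flag:
  assumes "\<tau> > 1" "i \<noteq> j" "cnj \<omega> * \<omega> = 1"
  shows "tilted_flag \<tau> \<omega> i j \<in> flag \<tau>"
proof -
  \<comment> \<open>The identity matrix in \<open>cip_tilted_mult\<close> yields plain inner
    products: 1 for equal parameters, 0 for opposite ones.\<close>
  have *: "cip (tilted_vec \<omega> i j) (tilted_vec \<omega>' i j) = (1 + cnj \<omega> * \<omega>') / 2" for \<omega> \<omega>'
    using cip_tilted_mult[of \<omega> i j "mat 1" \<omega>', unfolded matrix_vector_mul_lid] assms(2) by (simp add: mat_def)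
  show ?thesis
    unfolding tilted_flag_def
    by (intro spectral_in_flag assms(1)) (unfold *, simp_all add: assms(3))
qed

lemma D_diag_flag:
  assumes "hermitian y"
  shows "D (diag_flag \<tau> i j) y = (1 + \<tau>)\<^sup>2 * (Re (y $ i $ i))\<^sup>2 / 2 + (1 - \<tau>)\<^sup>2 * (Re (y $ j $ j))\<^sup>2 / 2
    + (1 + \<tau>) * (1 - \<tau>) * (2 * (cmod (y $ i $ j))\<^sup>2 - Re (y $ i $ i) * Re (y $ j $ j))"
  unfolding diag_flag_def D_spectral[OF assms] cip_axis_mult ..

text \<open>In the tilted basis the compression of \<open>y\<close> has diagonal entries (p + q)/2 +
  r and (p + q)/2 - r and off-diagonal entry (p - q)/2 - im, to be inserted into
  \<open>D_spectral\<close>.\<close>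

lemma D_tilted_flag:
  fixes y :: "complex^'n^'n" and i j :: 'n and \<omega> :: complex
  assumes y: "hermitian y" and \<omega>: "cnj \<omega> * \<omega> = 1"
  defines "p \<equiv> Re (y $ i $ i)" and "q \<equiv> Re (y $ j $ j)"
    and "r \<equiv> Re (\<omega> * y $ i $ j)" and "m \<equiv> Im (\<omega> * y $ i $ j)"
  shows "D (tilted_flag \<tau> \<omega> i j) y =
    (1 + \<tau>)\<^sup>2 * ((p + q) / 2 + r)\<^sup>2 / 2 + (1 - \<tau>)\<^sup>2 * ((p + q) / 2 - r)\<^sup>2 / 2
    + (1 + \<tau>) * (1 - \<tau>) * (2 * (((p - q) / 2)\<^sup>2 + m\<^sup>2) - ((p + q) / 2 + r) * ((p + q) / 2 - r))"
proof -
  have p: "y $ i $ i = of_real p" and q: "y $ j $ j = of_real q"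
    using hermitian_nth[OF y, of i i] hermitian_nth[OF y, of j j]
    by (simp_all add: p_def q_def complex_eq_iff)
  have z: "\<omega> * y $ i $ j = Complex r m" unfolding r_def m_def by (simp only: complex_surj)
  have w: "cnj \<omega> * y $ j $ i = Complex r (- m)"
    using arg_cong[OF z, of cnj] hermitian_nth[OF y, of i j] by (simp add: complex_cnj)
  have uu: "cip (tilted_vec \<omega> i j) (y *v tilted_vec \<omega> i j) = of_real ((p + q) / 2 + r)"
    unfolding cip_tilted_mult z w p q \<omega> by (simp add: complex_eq_iff)
  have vv: "cip (tilted_vec (- \<omega>) i j) (y *v tilted_vec (- \<omega>) i j) = of_real ((p + q) / 2 - r)"
    unfolding cip_tilted_mult by (simp add: z w p q \<omega>) (simp add: complex_eq_iff)
  have uv: "cip (tilted_vec \<omega> i j) (y *v tilted_vec (- \<omega>) i j) = Complex ((p - q) / 2) (- m)"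
    unfolding cip_tilted_mult by (simp add: z w p q \<omega>) (simp add: complex_eq_iff)
  show ?thesis
    unfolding tilted_flag_def D_spectral[OF y] uu vv uv Re_complex_of_real
    by (simp add: cmod_power2)
qed

lemma sum_fourth_roots: "(\<Sum>\<omega>\<in>{1, -1, \<i>, -\<i>}. h \<omega>) = h 1 + h (-1) + h \<i> + h (-\<i>)"
  for h :: "complex \<Rightarrow> real"
proof -
  have "(1::complex) \<notin> {-1, \<i>, -\<i>}" "(-1::complex) \<notin> {\<i>, -\<i>}" "\<i> \<notin> {-\<i>}"
    by (auto simp: complex_eq_iff)
  then show ?thesis by simp
qed

text \<open>The pair \<open>\<omega>\<close>, \<open>- \<omega>\<close> cancels the terms odd in the
  real part of \<open>\<omega> * y $ i $ j\<close>, and passing from 1 to \<open>\<i>\<close> swaps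
  the squares of the real and imaginary parts. So \<open>y $ i $ j\<close> enters only through its
  modulus.\<close>

lemma D_tilted_flag_sum:
  fixes y :: "complex^'n^'n"
  assumes y: "hermitian y"
  shows "(\<Sum>\<omega>\<in>{1, -1, \<i>, -\<i>}. D (tilted_flag \<tau> \<omega> i j) y) =
    4 * (((Re (y $ i $ i))\<^sup>2 + (Re (y $ j $ j))\<^sup>2) / 2 + (2 - \<tau>\<^sup>2) * (cmod (y $ i $ j))\<^sup>2
      + (2 * \<tau>\<^sup>2 - 1) * Re (y $ i $ i) * Re (y $ j $ j))"
proof -
  define S where "S = (Re (y $ i $ i) + Re (y $ j $ j)) / 2"
  define E where "E = (Re (y $ i $ i) - Re (y $ j $ j)) / 2"
  have p: "Re (y $ i $ i) = S + E" and q: "Re (y $ j $ j) = S - E"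
    by (simp_all add: S_def E_def field_simps)
  have 2: "(S + E + (S - E)) / 2 = S" "(S + E - (S - E)) / 2 = E" by simp_all
  define g where "g = Re (y $ i $ j)"
  define h where "h = Im (y $ i $ j)"
  define X where "X \<omega> = D (tilted_flag \<tau> \<omega> i j) y" for \<omega>
  \<comment> \<open>Isolates \<open>4 * \<tau> * S * r\<close>, the only term odd in
    \<open>r\<close>.\<close>
  have K: "(1 + \<tau>)\<^sup>2 * (S + r)\<^sup>2 / 2 + (1 - \<tau>)\<^sup>2 * (S - r)\<^sup>2 / 2
      + (1 + \<tau>) * (1 - \<tau>) * (2 * (E\<^sup>2 + m\<^sup>2) - (S + r) * (S - r))
    = (1 + \<tau>\<^sup>2) * (S\<^sup>2 + r\<^sup>2) + 4 * \<tau> * S * r + (1 - \<tau>\<^sup>2) * (2 * E\<^sup>2 + 2 * m\<^sup>2 - S\<^sup>2 + r\<^sup>2)" for r m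
    by (simp add: power2_eq_square field_simps)
  note X = D_tilted_flag[OF y, where \<tau> = \<tau> and i = i and j = j, folded X_def, unfolded p q 2 K]
  have Xs: "X 1 = (1 + \<tau>\<^sup>2) * (S\<^sup>2 + g\<^sup>2) + 4 * \<tau> * S * g + (1 - \<tau>\<^sup>2) * (2 * E\<^sup>2 + 2 * h\<^sup>2 - S\<^sup>2 + g\<^sup>2)"
    "X (-1) = (1 + \<tau>\<^sup>2) * (S\<^sup>2 + g\<^sup>2) - 4 * \<tau> * S * g + (1 - \<tau>\<^sup>2) * (2 * E\<^sup>2 + 2 * h\<^sup>2 - S\<^sup>2 + g\<^sup>2)"
    "X \<i> = (1 + \<tau>\<^sup>2) * (S\<^sup>2 + h\<^sup>2) - 4 * \<tau> * S * h + (1 - \<tau>\<^sup>2) * (2 * E\<^sup>2 + 2 * g\<^sup>2 - S\<^sup>2 + h\<^sup>2)"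
    "X (-\<i>) = (1 + \<tau>\<^sup>2) * (S\<^sup>2 + h\<^sup>2) + 4 * \<tau> * S * h + (1 - \<tau>\<^sup>2) * (2 * E\<^sup>2 + 2 * g\<^sup>2 - S\<^sup>2 + h\<^sup>2)"
    by (simp_all add: X g_def h_def)
  have SE: "((S + E)\<^sup>2 + (S - E)\<^sup>2) / 2 = S\<^sup>2 + E\<^sup>2" "(S + E) * (S - E) = S\<^sup>2 - E\<^sup>2"
    by (simp_all add: power2_eq_square algebra_simps)
  have "X 1 + X (-1) + X \<i> + X (-\<i>) =
      4 * (((S + E)\<^sup>2 + (S - E)\<^sup>2) / 2 + (2 - \<tau>\<^sup>2) * (g\<^sup>2 + h\<^sup>2) + (2 * \<tau>\<^sup>2 - 1) * (S + E) * (S - E))"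
    unfolding Xs SE mult.assoc[of _ "S + E"] by (simp add: algebra_simps)
  then show ?thesis
    unfolding sum_fourth_roots X_def[symmetric] p q cmod_power2 g_def[symmetric] h_def[symmetric] .
qed

section \<open>Summation over all pairs of axes\<close>

lemma sum_off_diagonal:
  fixes h :: "'n::finite \<Rightarrow> 'n \<Rightarrow> real"
  shows "(\<Sum>i\<in>UNIV. \<Sum>j\<in>UNIV - {i}. h i j) = (\<Sum>i\<in>UNIV. \<Sum>j\<in>UNIV. h i j) - (\<Sum>i\<in>UNIV. h i i)"
  by (simp add: sum_diff1 sum_subtractf)

text \<open>
  The weight \<open>\<alpha>\<close> (possibly negative) is chosen to cancel \<open>\<Sum>\<^sub>i y\<^sub>i\<^sub>i\<^sup>2\<close>, the only term of the sum
  that is not a unitary invariant of \<open>y\<close>.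
\<close>

lemma weighted_sum_D:
  fixes y :: "complex^'n^'n" and \<tau> :: real
  assumes \<tau>: "\<tau> > 1" and y: "y \<in> flag \<tau>"
  defines "f \<equiv> real CARD('n)"
  defines "\<alpha> \<equiv> (\<tau>\<^sup>2 - f + 2) / ((f + 1) * \<tau>\<^sup>2)"
  shows "(\<Sum>i\<in>UNIV. \<Sum>j\<in>UNIV - {i}. \<alpha> * D (diag_flag \<tau> i j) y
      + (1 - \<alpha>) / 4 * (\<Sum>\<omega>\<in>{1, -1, \<i>, -\<i>}. D (tilted_flag \<tau> \<omega> i j) y))
    = 2 * (3 * (f - 2) + 6 * f * \<tau>\<^sup>2 - (f + 2) * (\<tau>\<^sup>2)\<^sup>2) / (f + 1)"
proof -
  have h: "hermitian y" using y by (simp add: flag_def)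
  define t where "t = \<tau>\<^sup>2"
  define p where "p i = Re (y $ i $ i)" for i
  define c where "c i j = (cmod (y $ i $ j))\<^sup>2" for i j
  \<comment> \<open>\<open>\<alpha>\<close> affects the total only through \<open>\<beta>\<close>:
    the coefficients \<open>A\<close>, \<open>B\<close> and the sum \<open>a1 + a2\<close> are
    affine in it.\<close>
  define \<beta> where "\<beta> = \<alpha> * t"
  have f1: "f + 1 > 0" by (simp add: f_def)
  have \<beta>: "(f + 1) * \<beta> = t - f + 2"
  proof -
    have "\<beta> = (t - f + 2) / (f + 1)" using \<tau> unfolding \<beta>_def \<alpha>_def t_def by simp
    then show ?thesis using f1 by simp
  qed
  have sp: "(\<Sum>i\<in>UNIV. p i) = 2"
    using trace_flag(1)[OF \<tau> y] unfolding p_def trace_def by (metis Re_sum complex_Re_numeral)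
  have sc: "(\<Sum>i\<in>UNIV. \<Sum>j\<in>UNIV. c i j) = 2 + 2 * t"
    unfolding c_def sum_cmod_square_hermitian[OF h] trace_flag(2)[OF \<tau> y] t_def by simp
  have cii: "c i i = (p i)\<^sup>2" for i
    using hermitian_nth[OF h, of i i] by (simp add: c_def p_def cmod_power2 complex_eq_iff)
  define A where "A = 2 - t - \<beta>"
  define B where "B = 2 * t - 1 - \<beta>"
  define s2 where "s2 = (\<Sum>i\<in>UNIV. (p i)\<^sup>2)"
  define a1 where "a1 = \<alpha> * (1 + \<tau>)\<^sup>2 / 2 + (1 - \<alpha>) / 2"
  define a2 where "a2 = \<alpha> * (1 - \<tau>)\<^sup>2 / 2 + (1 - \<alpha>) / 2"
  define g where "g i j = a1 * (p i)\<^sup>2 + a2 * (p j)\<^sup>2 + A * c i j + B * (p i * p j)" for i j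
  have a12: "a1 + a2 = 1 + \<beta>"
    by (simp add: a1_def a2_def \<beta>_def t_def power2_eq_square field_simps)
  have "\<alpha> * D (diag_flag \<tau> i j) y
      + (1 - \<alpha>) / 4 * (\<Sum>\<omega>\<in>{1, -1, \<i>, -\<i>}. D (tilted_flag \<tau> \<omega> i j) y) = g i j" for i j
    unfolding D_diag_flag[OF h] D_tilted_flag_sum[OF h]
    unfolding p_def[symmetric] c_def[symmetric] g_def a1_def a2_def A_def B_def \<beta>_def t_def
    by (simp add: power2_eq_square field_simps)
  then have "(\<Sum>i\<in>UNIV. \<Sum>j\<in>UNIV - {i}. \<alpha> * D (diag_flag \<tau> i j) y
      + (1 - \<alpha>) / 4 * (\<Sum>\<omega>\<in>{1, -1, \<i>, -\<i>}. D (tilted_flag \<tau> \<omega> i j) y))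
    = (\<Sum>i\<in>UNIV. \<Sum>j\<in>UNIV. g i j) - (\<Sum>i\<in>UNIV. g i i)"
    by (simp only: sum_off_diagonal)
  also have "(\<Sum>i\<in>UNIV. g i i) = (1 + \<beta> + A + B) * s2"
    unfolding a12[symmetric] g_def cii s2_def
    by (simp add: sum_distrib_left algebra_simps sum.distrib power2_eq_square)
  also have "(\<Sum>i\<in>UNIV. \<Sum>j\<in>UNIV. g i j) = (1 + \<beta>) * f * s2 + A * (2 + 2 * t) + B * 4"
  proof -
    have pp: "(\<Sum>i\<in>UNIV. \<Sum>j\<in>UNIV. p i * p j) = 4"
      unfolding sum_product[symmetric] sp by simp
    have "(\<Sum>i\<in>UNIV. \<Sum>j\<in>UNIV. g i j) = a1 * (f * s2) + a2 * (f * s2)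
        + A * (\<Sum>i\<in>UNIV. \<Sum>j\<in>UNIV. c i j) + B * (\<Sum>i\<in>UNIV. \<Sum>j\<in>UNIV. p i * p j)"
      unfolding g_def s2_def f_def by (simp add: sum.distrib flip: sum_distrib_left)
    then show ?thesis unfolding sc pp a12[symmetric] by (simp add: algebra_simps)
  qed
  \<comment> \<open>The bracket multiplying \<open>s2\<close> vanishes by the equation for
    \<open>\<beta>\<close>, which is where the value of \<open>\<alpha>\<close> comes from.\<close>
  also have "(1 + \<beta>) * f * s2 + A * (2 + 2 * t) + B * 4 - (1 + \<beta> + A + B) * s2
      = s2 * ((f + 1) * \<beta> - (t - f + 2)) + 10 * t - 2 * t\<^sup>2 - \<beta> * (6 + 2 * t)"
    by (simp add: A_def B_def power2_eq_square algebra_simps)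
  also have "\<dots> = 10 * t - 2 * t\<^sup>2 - \<beta> * (6 + 2 * t)" unfolding \<beta> by simp
  also have "\<dots> = ((f + 1) * (10 * t - 2 * t\<^sup>2) - ((f + 1) * \<beta>) * (6 + 2 * t)) / (f + 1)"
    using f1 by (simp add: field_simps)
  also have "\<dots> = 2 * (3 * (f - 2) + 6 * f * t - (f + 2) * t\<^sup>2) / (f + 1)"
    unfolding \<beta> by (simp add: power2_eq_square algebra_simps)
  finally show ?thesis unfolding t_def .
qed

section \<open>Support and integrability\<close>

text \<open>The complement of the support is covered by relatively open null sets. By the Lindelof
  property countably many of them have the same union, which is therefore null.\<close>

lemma AE_supp:
  fixes \<rho> :: "'a::second_countable_topology measure"
  assumes sets: "sets \<rho> = sets (restrict_space borel F)"
  shows "AE x in \<rho>. x \<in> supp \<rho>"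
proof -
  have sp: "space \<rho> = F" using sets_eq_imp_space_eq[OF sets] by (simp add: space_restrict_space)
  have open_sets: "U \<in> sets \<rho>" if "openin (top_of_set F) U" for U
    using that unfolding sets sets_restrict_space openin_open by auto
  define \<F> where "\<F> = {U. openin (top_of_set F) U \<and> emeasure \<rho> U = 0}"
  obtain \<F>' where F': "\<F>' \<subseteq> \<F>" "countable \<F>'" "\<Union>\<F>' = \<Union>\<F>"
    using Lindelof_openin[of \<F> F] unfolding \<F>_def by blast
  have "\<Union>\<F> \<in> null_sets \<rho>"
    unfolding F'(3)[symmetric]
    using F'(1) open_sets by (intro null_sets_UN'[of \<F>' "\<lambda>U. U", simplified] F'(2))
      (auto simp: \<F>_def null_sets_def)
  moreover have "{x \<in> space \<rho>. x \<notin> supp \<rho>} \<subseteq> \<Union>\<F>"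
    by (auto simp: supp_def \<F>_def sp)
  ultimately show ?thesis by (rule AE_I')
qed

lemma continuous_on_D: "continuous_on S (D x)"
  unfolding D_def trace_def matrix_matrix_mult_def vec_lambda_beta
  by (intro continuous_intros)

lemma norm_flag:
  fixes y :: "complex^'n^'n"
  assumes "\<tau> > 1" "y \<in> flag \<tau>"
  shows "(norm y)\<^sup>2 = 2 + 2 * \<tau>\<^sup>2"
proof -
  have h: "hermitian y" using assms by (simp add: flag_def)
  have "(norm y)\<^sup>2 = (\<Sum>i\<in>UNIV. \<Sum>j\<in>UNIV. (cmod (y $ i $ j))\<^sup>2)"
    by (simp add: norm_vec_def L2_set_def sum_nonneg)
  then show ?thesis
    by (simp add: sum_cmod_square_hermitian[OF h] trace_flag(2)[OF assms] del: of_real_add)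
qed

text \<open>By \<open>norm_flag\<close>, F lies in a compact ball. The continuous function
  \<open>D x\<close> is bounded there, which suffices against a probability measure.\<close>

lemma integrable_D:
  fixes \<rho> :: "(complex^'n^'n) measure"
  assumes "\<tau> > 1" and sets: "sets \<rho> = sets (restrict_space borel (flag \<tau>))" and "prob_space \<rho>"
  shows "integrable \<rho> (D x)"
proof -
  interpret prob_space \<rho> by fact
  have sp: "space \<rho> = flag \<tau>" using sets_eq_imp_space_eq[OF sets] by (simp add: space_restrict_space)
  have "flag \<tau> \<subseteq> cball (0 :: complex^'n^'n) (sqrt (2 + 2 * \<tau>\<^sup>2))"
  proof
    fix y :: "complex^'n^'n" assume "y \<in> flag \<tau>"
    then have "norm y = sqrt (2 + 2 * \<tau>\<^sup>2)"
      by (metis norm_flag[OF assms(1)] norm_ge_zero real_sqrt_unique)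
    then show "y \<in> cball 0 (sqrt (2 + 2 * \<tau>\<^sup>2))" by simp
  qed
  moreover have "bounded (D x ` cball 0 (sqrt (2 + 2 * \<tau>\<^sup>2)))"
    by (intro compact_imp_bounded compact_continuous_image continuous_on_D compact_cball)
  ultimately have "bounded (D x ` flag \<tau>)" by (meson bounded_subset image_mono)
  then obtain B where "\<And>y. y \<in> flag \<tau> \<Longrightarrow> norm (D x y) \<le> B" by (auto simp: bounded_iff)
  moreover have "D x \<in> borel_measurable \<rho>"
    unfolding measurable_cong_sets[OF sets refl]
    by (intro borel_measurable_continuous_on_restrict continuous_on_D)
  ultimately show ?thesis by (intro integrable_const_bound[where B = B]) (auto simp: sp)
qed

section \<open>The sign of the constant value of d\<close>

theorem theorem6p2:
  fixes \<tau> :: real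
  assumes "CARD('n::finite) > 2"
    and "\<tau> > 1"
    and "\<tau>\<^sup>2 > (3 * real CARD('n) + 2 * sqrt (3 * ((real CARD('n))\<^sup>2 - 1))) / (2 + real CARD('n))"
  shows "\<not> (\<exists>\<rho> :: (complex^'n^'n) measure. generically_timelike_minimizer \<tau> \<rho>)"
proof
  assume "\<exists>\<rho> :: (complex^'n^'n) measure. generically_timelike_minimizer \<tau> \<rho>"
  then obtain \<rho> :: "(complex^'n^'n) measure"
    where sets: "sets \<rho> = sets (restrict_space borel (flag \<tau>))" and ps: "prob_space \<rho>"
      and nonneg: "\<And>x y. x \<in> supp \<rho> \<Longrightarrow> y \<in> supp \<rho> \<Longrightarrow> D x y \<ge> 0"
      and const: "(\<lambda>x. \<integral>y. D x y \<partial>\<rho>) constant_on flag \<tau>"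
    unfolding generically_timelike_minimizer_def minimizer_def normalized_measures_def by blast
  interpret prob_space \<rho> by (rule ps)
  have sp: "space \<rho> = flag \<tau>" using sets_eq_imp_space_eq[OF sets] by (simp add: space_restrict_space)
  obtain c where c: "\<And>x. x \<in> flag \<tau> \<Longrightarrow> (\<integral>y. D x y \<partial>\<rho>) = c"
    using const unfolding constant_on_def by blast
  note int = integrable_D[OF assms(2) sets ps]
  have ae: "AE x in \<rho>. x \<in> supp \<rho>" by (rule AE_supp[OF sets])
  have "c \<ge> 0"
  proof -
    \<comment> \<open>A property true almost everywhere for a probability measure holds somewhere,
      so the support is non-empty.\<close>
    obtain x where x: "x \<in> supp \<rho>" using ae eventually_happens'[OF ae_filter_bot] by blast
    then have "x \<in> flag \<tau>" by (simp add: supp_def sp)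
    moreover have "AE y in \<rho>. 0 \<le> D x y" using ae by eventually_elim (rule nonneg[OF x])
    ultimately show ?thesis using c integral_nonneg_AE by metis
  qed
  define f where "f = real CARD('n)"
  define \<alpha> where "\<alpha> = (\<tau>\<^sup>2 - f + 2) / ((f + 1) * \<tau>\<^sup>2)"
  define w where "w y i j = \<alpha> * D (diag_flag \<tau> i j) y
      + (1 - \<alpha>) / 4 * (\<Sum>\<omega>\<in>{1, -1, \<i>, -\<i>}. D (tilted_flag \<tau> \<omega> i j) y)"
    for y :: "complex^'n^'n" and i j
  \<comment> \<open>This is \<open>f * (f - 1)\<close> times the Haar average of \<open>D\<close>:
    each ordered pair of distinct axes carries total weight one.\<close>
  define \<nu> where "\<nu> = 2 * (3 * (f - 2) + 6 * f * \<tau>\<^sup>2 - (f + 2) * (\<tau>\<^sup>2)\<^sup>2) / (f + 1)"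
  have f: "f > 2" using assms(1) by (simp add: f_def)
  have int_w: "integrable \<rho> (\<lambda>y. w y i j)" for i j
    unfolding w_def by (intro Bochner_Integration.integrable_add integrable_mult_right
        Bochner_Integration.integrable_sum int)
  \<comment> \<open>The weight \<open>\<alpha>\<close> and the four weights
    \<open>(1 - \<alpha>) / 4\<close> add up to one, so the combination of values of d returns
    \<open>c\<close>.\<close>
  have w_eq: "(\<integral>y. w y i j \<partial>\<rho>) = c" if "i \<noteq> j" for i j
  proof -
    have "(\<integral>y. w y i j \<partial>\<rho>) = \<alpha> * (\<integral>y. D (diag_flag \<tau> i j) y \<partial>\<rho>)
        + (1 - \<alpha>) / 4 * (\<Sum>\<omega>\<in>{1, -1, \<i>, -\<i>}. \<integral>y. D (tilted_flag \<tau> \<omega> i j) y \<partial>\<rho>)"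
      unfolding w_def
      by (subst Bochner_Integration.integral_add)
        (simp_all only: integral_mult_right_zero Bochner_Integration.integral_sum[OF int] int
          integrable_mult_right Bochner_Integration.integrable_sum)
    also have "(\<Sum>\<omega>\<in>{1, -1, \<i>, -\<i>}. \<integral>y. D (tilted_flag \<tau> \<omega> i j) y \<partial>\<rho>) = (\<Sum>\<omega>\<in>{1, -1, \<i>, -\<i>}. c)"
      by (intro sum.cong refl c tilted_flag_in_flag assms(2) that) auto
    also have "\<dots> = 4 * c" unfolding sum_fourth_roots by simp
    also have "(\<integral>y. D (diag_flag \<tau> i j) y \<partial>\<rho>) = c"
      by (intro c diag_flag_in_flag assms(2) that)
    finally show ?thesis by (simp add: field_simps)
  qed
  \<comment> \<open>The sum over pairs is integrated in two ways: each pair contributes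
    \<open>c\<close>, while for fixed \<open>y\<close> the whole sum is the constant
    \<open>\<nu>\<close>.\<close>
  have "f * (f - 1) * c = (\<Sum>i\<in>(UNIV :: 'n set). \<Sum>j\<in>UNIV - {i}. c)"
    by (simp add: f_def card_Diff_singleton)
  also have "\<dots> = (\<Sum>i\<in>UNIV. \<Sum>j\<in>UNIV - {i}. \<integral>y. w y i j \<partial>\<rho>)"
    by (intro sum.cong refl) (simp add: w_eq)
  also have "\<dots> = (\<integral>y. (\<Sum>i\<in>UNIV. \<Sum>j\<in>UNIV - {i}. w y i j) \<partial>\<rho>)"
    by (simp add: int_w)
  also have "\<dots> = (\<integral>y. \<nu> \<partial>\<rho>)"
    using weighted_sum_D[OF assms(2)]
    by (intro Bochner_Integration.integral_cong refl) (simp add: sp w_def \<nu>_def f_def \<alpha>_def)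
  also have "\<dots> = \<nu>" by (simp add: prob_space)
  finally have "f * (f - 1) * c = \<nu>" .
  then have "\<nu> \<ge> 0" using mult_nonneg_nonneg[of "f * (f - 1)" c] \<open>c \<ge> 0\<close> f by simp
  moreover have "\<nu> < 0"
  proof -
    \<comment> \<open>Completing the square in \<open>\<tau>\<^sup>2\<close>: \<open>f + 2\<close>
      times the bracket in \<open>\<nu>\<close> equals s^2 - r^2, and the bound on
      \<open>\<tau>\<^sup>2\<close> says exactly that \<open>s < r\<close>.\<close>
    define s where "s = 2 * sqrt (3 * (f\<^sup>2 - 1))"
    define r where "r = (f + 2) * \<tau>\<^sup>2 - 3 * f"
    have f2: "f\<^sup>2 \<ge> 1" using f by (simp add: one_le_power)
    have "s \<ge> 0" using f2 by (simp add: s_def)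
    have "s < r" using assms(3) f unfolding s_def r_def f_def[symmetric] by (simp add: field_simps)
    then have "s\<^sup>2 < r\<^sup>2" using \<open>s \<ge> 0\<close> by (intro power_strict_mono) auto
    moreover have "s\<^sup>2 = 12 * (f\<^sup>2 - 1)" using f2 by (simp add: s_def power_mult_distrib)
    moreover have "(f + 2) * (3 * (f - 2) + 6 * f * \<tau>\<^sup>2 - (f + 2) * (\<tau>\<^sup>2)\<^sup>2) = 12 * (f\<^sup>2 - 1) - r\<^sup>2"
      unfolding r_def by (simp add: power2_eq_square algebra_simps)
    ultimately have "(f + 2) * (3 * (f - 2) + 6 * f * \<tau>\<^sup>2 - (f + 2) * (\<tau>\<^sup>2)\<^sup>2) < 0" by simp
    then have "3 * (f - 2) + 6 * f * \<tau>\<^sup>2 - (f + 2) * (\<tau>\<^sup>2)\<^sup>2 < 0"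
      using f by (simp add: mult_less_0_iff)
    then show ?thesis using f unfolding \<nu>_def by (simp add: divide_less_0_iff mult_less_0_iff)
  qed
  ultimately show False by simp
qed

end
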